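(* Let $Q^T\tau$ be a system of estimable functions, where $Q$ is a $v\times s$ matrix with $\mathcal{C}(Q)\subseteq\mathcal{E}$, and suppose that $r=\mathrm{rank}(Q)$ satisfies $r=\dim(\mathcal{E})$. Let $\xi$ be a feasible design for $Q^T\tau$. Then the information matrix $N_Q(\xi)=(Q^TC^-(\xi)Q)^+$ for $Q^T\tau$ and the weighted information matrix $C_{W_Q}(\xi)=W_Q^{-1/2}C(\xi)W_Q^{-1/2}$, where $W_Q=I-P_\tau+QQ^T$, have the same non-zero eigenvalues, including multiplicities.
   Context: Consider the linear model $y=X(\xi)\tau+L\beta+\varepsilon$, where $y\in\mathbb{R}^n$ is the response, $\tau\in\mathbb{R}^v$ is the vector of parameters of interest, $\beta\in\mathbb{R}^m$ is the vector of nuisance parameters, $\varepsilon$ satisfies $E(\varepsilon)=0$ and $\mathrm{Var}(\varepsilon)=I_n$, the design $\xi$ determines the matrix $X(\xi)$, and $L$ does not depend on $\xi$. The information matrix of $\xi$ for $\tau$ is the $v\times v$ non-negative definite matrix $C(\xi)=X^T(\xi)(I-P_L)X(\xi)$, where $P_L=L(L^TL)^-L^T$ is the orthogonal projector on the column space of $L$. Write $\mathcal{C}(A)$ for the column space of $A$, $A^+$ for the Moore-Penrose inverse, and $A^-$ for any generalized inverse ($AA^-A=A$). A function $q^T\tau$ is estimable under $\xi$ iff $q\in\mathcal{C}(C(\xi))$. Standing assumption: all competing designs $\xi$ have the same estimation space, i.e. there is a fixed subspace $\mathcal{E}\subseteq\mathbb{R}^v$ with $\mathcal{C}(C(\xi))=\mathcal{E}$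 for every $\xi$. $P_\tau$ is the $v\times v$ matrix of the orthogonal projection on $\mathcal{E}$. A system $Q^T\tau$ ($Q$ of size $v\times s$) is a system of estimable functions if $\mathcal{C}(Q)\subseteq\mathcal{E}$; a design $\xi$ is feasible for $Q^T\tau$ if $Q^T\tau$ is estimable under $\xi$, i.e. $\mathcal{C}(Q)\subseteq\mathcal{C}(C(\xi))$. Under this condition $Q^TC^-(\xi)Q$ does not depend on the choice of generalized inverse. When $\mathrm{rank}(Q)=\dim(\mathcal{E})$, $W_Q=I-P_\tau+QQ^T$ is positive definite, and $W_Q^{-1/2}$ is the inverse of its positive definite square root. *)

theory Defs
  imports "HOL-Analysis.Analysis" "HOL-Computational_Algebra.Polynomial"
begin

text \<open>Conventions: \<open>real^'k^'n\<close> is the type of matrices with rows indexed by \<open>'n\<close> and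
  columns indexed by \<open>'k\<close>.\<close>

definition column_space :: "real^'k^'n \<Rightarrow> (real^'n) set"
  where "column_space A = span (columns A)"

definition is_orth_proj :: "(real^'n) set \<Rightarrow> real^'n^'n \<Rightarrow> bool"
  where "is_orth_proj S P \<longleftrightarrow> (\<forall>x. P *v x \<in> S \<and> (\<forall>y\<in>S. orthogonal y (x - P *v x)))"

definition orth_proj :: "(real^'n) set \<Rightarrow> real^'n^'n"
  where "orth_proj S = (THE P. is_orth_proj S P)"

definition is_generalized_inverse :: "real^'k^'n \<Rightarrow> real^'n^'k \<Rightarrow> bool"
  where "is_generalized_inverse A G \<longleftrightarrow> A ** G ** A = A"

definition is_moore_penrose :: "real^'k^'n \<Rightarrow> real^'n^'k \<Rightarrow> bool"
  where "is_moore_penrose A B \<longleftrightarrow>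
    A ** B ** A = A \<and> B ** A ** B = B \<and>
    transpose (A ** B) = A ** B \<and> transpose (B ** A) = B ** A"

definition moore_penrose :: "real^'k^'n \<Rightarrow> real^'n^'k"
  where "moore_penrose A = (THE B. is_moore_penrose A B)"

definition positive_definite :: "real^'n^'n \<Rightarrow> bool"
  where "positive_definite A \<longleftrightarrow> transpose A = A \<and> (\<forall>x. x \<noteq> 0 \<longrightarrow> 0 < x \<bullet> (A *v x))"

definition pd_sqrt :: "real^'n^'n \<Rightarrow> real^'n^'n"
  where "pd_sqrt A = (THE B. positive_definite B \<and> B ** B = A)"

definition char_polynomial :: "real^'n^'n \<Rightarrow> real poly"
  where "char_polynomial A = det (mat [:0, 1:] - map_matrix (\<lambda>a. [:a:]) A)"

text \<open>The multiset of real eigenvalues, counted with algebraic multiplicity. It is used below for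
  symmetric matrices only, all of whose eigenvalues are real, and for which algebraic and
  geometric multiplicities coincide.\<close>

definition eigenvalues :: "real^'n^'n \<Rightarrow> real multiset"
  where "eigenvalues A = proots (char_polynomial A)"

definition nonzero_eigenvalues :: "real^'n^'n \<Rightarrow> real multiset"
  where "nonzero_eigenvalues A = {#l \<in># eigenvalues A. l \<noteq> 0#}"

text \<open>The information matrix for \<open>\<tau>\<close> in the model \<open>y = X \<tau> + L \<beta> + \<epsilon>\<close>; see
  \<open>orth_proj_column_space\<close> below for the formula \<open>P\<^sub>L = L (L\<^sup>T L)\<^sup>- L\<^sup>T\<close>.\<close>

definition information_matrix :: "real^'v^'n \<Rightarrow> real^'m^'n \<Rightarrow> real^'v^'v"
  where "information_matrix X L = transpose X ** (mat 1 - orth_proj (column_space L)) ** X"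

text \<open>A design with information matrix \<open>C\<close> is feasible for \<open>Q\<^sup>T \<tau>\<close>.\<close>

definition feasible :: "real^'v^'v \<Rightarrow> real^'s^'v \<Rightarrow> bool"
  where "feasible C Q \<longleftrightarrow> column_space Q \<subseteq> column_space C"

text \<open>The weight matrix \<open>W\<^sub>Q\<close> for estimation space \<open>E\<close>.\<close>

definition weight_matrix :: "(real^'v) set \<Rightarrow> real^'s^'v \<Rightarrow> real^'v^'v"
  where "weight_matrix E Q = mat 1 - orth_proj E + Q ** transpose Q"

definition weighted_information_matrix :: "real^'v^'v \<Rightarrow> real^'v^'v \<Rightarrow> real^'v^'v"
  where "weighted_information_matrix W C = matrix_inv (pd_sqrt W) ** C ** matrix_inv (pd_sqrt W)"

text \<open>Only the product \<open>Q\<^sup>T G Q\<close>, for \<open>G\<close> a generalized inverse of the information matrix of a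
  feasible design, is independent of the choice of \<open>G\<close>, so \<open>G\<close> is a parameter.\<close>

definition system_information_matrix :: "real^'s^'v \<Rightarrow> real^'v^'v \<Rightarrow> real^'s^'s"
  where "system_information_matrix Q G = moore_penrose (transpose Q ** G ** Q)"

lemma is_orth_proj_unique:
  assumes S: "subspace S" and P: "is_orth_proj S P" and R: "is_orth_proj S R"
  shows "P = R"
proof -
  have "P *v x = R *v x" for x
  proof -
    let ?d = "P *v x - R *v x"
    have "?d \<in> S"
      using P R S by (simp add: is_orth_proj_def subspace_diff)
    then have "?d \<bullet> (x - P *v x) = 0" "?d \<bullet> (x - R *v x) = 0"
      using P R by (auto simp: is_orth_proj_def orthogonal_def)
    then have "?d \<bullet> ?d = 0"
      by (simp add: inner_diff_right)
    then show ?thesis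
      by simp
  qed
  then show ?thesis
    by (simp add: matrix_eq)
qed

lemma orth_proj_eqI:
  assumes "subspace S" "is_orth_proj S P"
  shows "orth_proj S = P"
  unfolding orth_proj_def using assms by (blast intro: is_orth_proj_unique)

lemma column_space_eq_range: "column_space A = range ((*v) A)"
proof
  show "column_space A \<subseteq> range ((*v) A)"
    unfolding column_space_def
  proof (rule span_minimal)
    show "columns A \<subseteq> range ((*v) A)"
      by (auto simp: columns_def simp flip: matrix_vector_mult_basis)
    show "subspace (range ((*v) A))"
      by (intro linear_subspace_image) auto
  qed
  show "range ((*v) A) \<subseteq> column_space A"
    unfolding column_space_def by (auto intro: matrix_vector_mult_in_columnspace)
qed

lemma gram_generalized_inverse:
  fixes L :: "real^'m^'n"
  assumes "is_generalized_inverse (transpose L ** L) G"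
  shows "L ** G ** transpose L ** L = L"
proof -
  let ?K = "transpose L ** L"
  have K: "?K ** G ** ?K = ?K"
    using assms by (simp add: is_generalized_inverse_def)
  have "(L ** G ** transpose L ** L) *v x = L *v x" for x
  proof -
    let ?z = "G *v (?K *v x) - x"
    have "?K *v (G *v (?K *v x)) = ?K *v x"
      using K by (metis matrix_vector_mul_assoc)
    then have "?K *v ?z = 0"
      by (simp add: matrix_vector_mult_diff_distrib)
    then have "?z \<bullet> (transpose L *v (L *v ?z)) = 0"
      by (simp add: matrix_vector_mul_assoc)
    then have "(L *v ?z) \<bullet> (L *v ?z) = 0"
      by (metis dot_lmul_matrix inner_commute vector_transpose_matrix transpose_matrix_vector)
    then have "L *v ?z = 0"
      by simp
    then show ?thesis
      by (simp add: matrix_vector_mult_diff_distrib matrix_vector_mul_assoc matrix_mul_assoc)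
  qed
  then show ?thesis
    by (simp add: matrix_eq)
qed

lemma orth_proj_column_space:
  fixes L :: "real^'m^'n"
  assumes G: "is_generalized_inverse (transpose L ** L) G"
  shows "orth_proj (column_space L) = L ** G ** transpose L"
proof (rule orth_proj_eqI)
  show "subspace (column_space L)"
    by (simp add: column_space_def)
  have "is_generalized_inverse (transpose L ** L) (transpose G)"
    using arg_cong[OF G[unfolded is_generalized_inverse_def], of transpose]
    by (simp add: is_generalized_inverse_def matrix_transpose_mul matrix_mul_assoc)
  then have "L ** transpose G ** transpose L ** L = L"
    by (rule gram_generalized_inverse)
  from arg_cong[OF this, of transpose]
  have Lt: "transpose L ** (L ** G ** transpose L) = transpose L"
    by (simp add: matrix_transpose_mul matrix_mul_assoc)
  show "is_orth_proj (column_space L) (L ** G ** transpose L)"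
    unfolding is_orth_proj_def
  proof (intro allI conjI ballI)
    fix x :: "real^'n"
    show "(L ** G ** transpose L) *v x \<in> column_space L"
      by (simp add: column_space_eq_range flip: matrix_vector_mul_assoc)
    fix y
    assume "y \<in> column_space L"
    then obtain z where y: "y = L *v z"
      by (auto simp: column_space_eq_range)
    have "transpose L *v (x - (L ** G ** transpose L) *v x) = 0"
      by (simp add: matrix_vector_mult_diff_distrib matrix_vector_mul_assoc Lt
               del: transpose_matrix_vector)
    then show "orthogonal y (x - (L ** G ** transpose L) *v x)"
      unfolding y orthogonal_def
      by (metis dot_lmul_matrix inner_zero_right vector_transpose_matrix)
  qed
qed

end

theory Submission
  imports Defs
begin

text \<open>Write \<open>W = W\<^sub>Q\<close> and \<open>C = C(\<xi>)\<close>. The hypothesis on the rank makes the columns of \<open>Q\<close> span \<open>E\<close>,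
  so \<open>W\<close> is positive definite, and \<open>P\<^sub>\<tau> W = Q Q\<^sup>T\<close> gives \<open>Q Q\<^sup>T W\<inverse> = P\<^sub>\<tau> = W\<inverse> Q Q\<^sup>T\<close>. With these
  identities one checks the four Penrose equations to see that
  \<open>N\<^sub>Q(\<xi>) = Q\<^sup>T W\<inverse> C W\<inverse> Q\<close>. Since \<open>A B\<close> and \<open>B A\<close> have the same nonzero eigenvalues, these are
  the nonzero eigenvalues of \<open>C W\<inverse> Q Q\<^sup>T W\<inverse> = C P\<^sub>\<tau> W\<inverse> = C W\<inverse>\<close>, hence also those of
  \<open>W\<^sup>-\<^sup>1\<^sup>/\<^sup>2 C W\<^sup>-\<^sup>1\<^sup>/\<^sup>2\<close>.\<close>

section \<open>Eigenvalues of products\<close>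

text \<open>In the Leibniz expansion only permutations fixing every index outside
  \<open>range f\<close> survive, because those rows are diagonal. Transport along \<open>f\<close>
  keeps signs, so the surviving terms form the smaller determinant.\<close>

lemma det_diagonal_rows:
  fixes f :: "'a::finite \<Rightarrow> 'n::finite" and A :: "'r::comm_ring_1^'n^'n"
  assumes f: "inj f" and A: "\<And>i j. i \<notin> range f \<Longrightarrow> j \<noteq> i \<Longrightarrow> A $ i $ j = 0"
  shows "det A = (\<Prod>i\<in>- range f. A $ i $ i) * det (\<chi> i j. A $ f i $ f j)"
proof -
  let ?g = "map_permutation UNIV f"
  let ?t = "\<lambda>p. of_int (sign p) * (\<Prod>i\<in>UNIV. A $ i $ p i)"
  have bij: "bij_betw f UNIV (range f)"
    using f by (simp add: bij_betw_def)
  have vanish: "?t p = 0" if p: "p permutes UNIV" "\<not> p permutes range f" for p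
  proof -
    obtain i where "i \<notin> range f" "p i \<noteq> i"
      using permutes_superset[OF p(1), of "range f"] p(2) by blast
    then have "A $ i $ p i = 0" using A by blast
    then have "(\<Prod>i\<in>UNIV. A $ i $ p i) = 0"
      by (intro prod_zero) auto
    then show ?thesis by simp
  qed
  \<comment> \<open>Reindexing by permutations of the whole type \<open>'a\<close> turns the sum
    over permutations of a subset into a sum that is again a \<open>det\<close>.\<close>
  have img: "{p. p permutes range f} = ?g ` {p. p permutes UNIV}"
  proof (intro equalityI subsetI)
    fix p assume p: "p \<in> {p. p permutes range f}"
    let ?q = "map_permutation (range f) (inv f) p"
    have "?q permutes UNIV"
      using map_permutation_permutes[OF bij_betw_inv_into[OF bij]] p by blast
    moreover have "?g ?q = p"
      using p f by (intro map_permutation_compose_inv[OF bij_betw_inv_into[OF bij]]) auto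
    ultimately show "p \<in> ?g ` {p. p permutes UNIV}" by (metis image_eqI mem_Collect_eq)
  qed (auto intro: map_permutation_permutes[OF bij])
  have inj: "inj_on ?g {p. p permutes UNIV}"
  proof (rule inj_on_inverseI)
    fix p :: "'a \<Rightarrow> 'a" assume "p \<in> {p. p permutes UNIV}"
    then show "map_permutation (range f) (inv f) (?g p) = p"
      using map_permutation_compose_inv[OF bij] f by simp
  qed
  have prod_term: "?t (?g p) =
      (\<Prod>i\<in>- range f. A $ i $ i) * (of_int (sign p) * (\<Prod>i\<in>UNIV. A $ f i $ f (p i)))"
    if p: "p permutes UNIV" for p
  proof -
    have "(\<Prod>i\<in>UNIV. A $ i $ ?g p i) =
        (\<Prod>i\<in>- range f. A $ i $ ?g p i) * (\<Prod>i\<in>range f. A $ i $ ?g p i)"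
      using prod.subset_diff[of "range f" UNIV] by (simp add: Compl_eq_Diff_UNIV)
    also have "(\<Prod>i\<in>- range f. A $ i $ ?g p i) = (\<Prod>i\<in>- range f. A $ i $ i)"
      using permutes_not_in[OF map_permutation_permutes[OF bij p]] by (intro prod.cong refl) (metis ComplD)
    also have "(\<Prod>i\<in>range f. A $ i $ ?g p i) = (\<Prod>i\<in>UNIV. A $ f i $ f (p i))"
      by (simp only: prod.reindex[OF f] map_permutation_apply[OF f] o_def UNIV_I)
    finally show ?thesis
      using sign_map_permutation[OF f p] by (simp add: mult_ac)
  qed
  have "det A = (\<Sum>p | p permutes UNIV. ?t p)"
    by (rule det_def)
  also have "\<dots> = (\<Sum>p | p permutes range f. ?t p)"
    by (intro sum.mono_neutral_right) (use vanish in \<open>auto intro: permutes_subset simp: finite_permutations\<close>)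
  also have "\<dots> = (\<Sum>p | p permutes UNIV. ?t (?g p))"
    unfolding img sum.reindex[OF inj] by (simp only: o_def)
  also have "\<dots> = (\<Prod>i\<in>- range f. A $ i $ i) * det (\<chi> i j. A $ f i $ f j)"
    unfolding det_def sum_distrib_left by (intro sum.cong refl) (simp only: prod_term mem_Collect_eq vec_lambda_beta)
  finally show ?thesis .
qed

text \<open>The sum type as index type lets blocks of different sizes be glued without index
  arithmetic.\<close>

definition block_matrix ::
    "'r^'a^'a \<Rightarrow> 'r^'b^'a \<Rightarrow> 'r^'a^'b \<Rightarrow> 'r^'b^'b \<Rightarrow> 'r::comm_ring_1^('a::finite + 'b::finite)^('a + 'b)"
  where "block_matrix A B C D =
    (\<chi> i j. case i of
        Inl i \<Rightarrow> (case j of Inl j \<Rightarrow> A $ i $ j | Inr j \<Rightarrow> B $ i $ j)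
      | Inr i \<Rightarrow> (case j of Inl j \<Rightarrow> C $ i $ j | Inr j \<Rightarrow> D $ i $ j))"

lemma sum_UNIV_sum_type:
  "sum g (UNIV :: ('a::finite + 'b::finite) set) = (\<Sum>i\<in>UNIV. g (Inl i)) + (\<Sum>i\<in>UNIV. g (Inr i))"
  by (subst UNIV_sum, subst sum.union_disjoint) (auto simp: sum.reindex)

lemma block_matrix_mult:
  "block_matrix A B C D ** block_matrix A' B' C' D' =
    block_matrix (A ** A' + B ** C') (A ** B' + B ** D') (C ** A' + D ** C') (C ** B' + D ** D')"
  by (auto simp: vec_eq_iff block_matrix_def matrix_matrix_mult_def sum_UNIV_sum_type split: sum.split)

lemma transpose_block_matrix:
  "transpose (block_matrix A B C D) =
    block_matrix (transpose A) (transpose C) (transpose B) (transpose D)"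
  by (auto simp: vec_eq_iff block_matrix_def transpose_def split: sum.split)

lemma transpose_zero [simp]: "transpose 0 = 0"
  by (simp add: vec_eq_iff transpose_def)

lemma range_Inl_compl: "- range Inl = range Inr" "- range Inr = range Inl"
  by (auto, (metis obj_sumE rangeI)+)

lemma det_block_matrix_lower_scalar:
  fixes A :: "'r::comm_ring_1^'a^'a" and B :: "'r^'b^'a"
  shows "det (block_matrix A B 0 (mat c) :: 'r^('a + 'b)^('a + 'b)) = c ^ CARD('b) * det A"
  by (subst det_diagonal_rows[of Inl])
     (auto simp: block_matrix_def range_Inl_compl prod.reindex mat_def split: sum.split)

lemma det_block_matrix_upper_scalar:
  fixes D :: "'r::comm_ring_1^'b^'b" and B :: "'r^'b^'a"
  shows "det (block_matrix (mat c) B 0 D :: 'r^('a + 'b)^('a + 'b)) = c ^ CARD('a) * det D"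
proof -
  \<comment> \<open>The upper rows contain \<open>B\<close> and need not be diagonal. After
    transposition they are, and \<open>det_diagonal_rows\<close> applies with
    \<open>f = Inr\<close>.\<close>
  have "det (block_matrix (mat c) B 0 D) = det (block_matrix (mat c) 0 (transpose B) (transpose D))"
    by (subst det_transpose[symmetric]) (simp add: transpose_block_matrix transpose_mat)
  also have "\<dots> = c ^ CARD('a) * det (transpose D)"
    by (subst det_diagonal_rows[of Inr])
       (auto simp: block_matrix_def range_Inl_compl prod.reindex mat_def split: sum.split)
  finally show ?thesis by simp
qed

text \<open>Multiplying the block matrix with rows \<open>(c, A)\<close> and \<open>(B, 1)\<close> by block triangular matrices on
  either side clears \<open>B\<close> and exposes the two determinants.\<close>

lemma det_scalar_minus_mult_commute:
  fixes A :: "'r::comm_ring_1^'b^'a" and B :: "'r^'a^'b"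
  shows "c ^ CARD('b) * det (mat c - A ** B) = c ^ CARD('a) * det (mat c - B ** A)"
proof -
  let ?M = "block_matrix (mat c) A B (mat 1)"
  have neg: "M ** (- N) = - (M ** N)" "(- N) ** M' = - (N ** M')"
    for N :: "'r^'m^'k" and M :: "'r^'k^'l" and M' :: "'r^'l^'m"
    by (simp_all add: vec_eq_iff matrix_matrix_mult_def sum_negf)
  \<comment> \<open>The two scalar matrices have different sizes. This identity cancels the lower
    left block when \<open>?M\<close> is multiplied from the left.\<close>
  have comm: "mat c ** B = B ** mat c"
    by (simp add: vec_eq_iff matrix_matrix_mult_def mat_def if_distrib if_distribR mult.commute cong: if_cong)
  have lower: "det (block_matrix (mat 1) 0 (- B) (mat d)) = d ^ CARD('b)" for d
    by (subst det_transpose[symmetric])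
       (simp add: transpose_block_matrix transpose_mat transpose_zero det_block_matrix_lower_scalar)
  have "?M ** block_matrix (mat 1) 0 (- B) (mat 1) = block_matrix (mat c - A ** B) A 0 (mat 1)"
    by (simp add: block_matrix_mult neg)
  from arg_cong[OF this, of det] have "det ?M = det (mat c - A ** B)"
    by (simp add: det_mul lower det_block_matrix_lower_scalar)
  moreover have "block_matrix (mat 1) 0 (- B) (mat c) ** ?M = block_matrix (mat c) A 0 (mat c - B ** A)"
    by (simp add: block_matrix_mult neg comm)
  from arg_cong[OF this, of det]
  have "c ^ CARD('b) * det ?M = c ^ CARD('a) * det (mat c - B ** A)"
    by (simp add: det_mul lower det_block_matrix_upper_scalar)
  ultimately show ?thesis by simp
qed

section \<open>Characteristic polynomials and non-zero eigenvalues\<close>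

lemma map_matrix_const_poly_mult:
  fixes A :: "real^'b^'a" and B :: "real^'c^'b"
  shows "map_matrix (\<lambda>a. [:a:]) (A ** B) = map_matrix (\<lambda>a. [:a:]) A ** map_matrix (\<lambda>a. [:a:]) B"
  by (simp add: vec_eq_iff map_matrix_def matrix_matrix_mult_def sum_to_poly mult.commute)

text \<open>The two characteristic polynomials agree up to powers of the indeterminate, hence differ
  only in the multiplicity of the root 0, which the filter removes.\<close>

lemma nonzero_eigenvalues_mult_commute:
  fixes A :: "real^'b^'a" and B :: "real^'a^'b"
  shows "nonzero_eigenvalues (A ** B) = nonzero_eigenvalues (B ** A)"
proof -
  let ?p = "char_polynomial (A ** B)" and ?q = "char_polynomial (B ** A)"
  \<comment> \<open>The determinant identity is used over the polynomial ring with \<open>c\<close>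
    the indeterminate. Since that is not a unit, its powers stay on both sides.\<close>
  have eq: "[:0, 1:] ^ CARD('b) * ?p = [:0, 1:] ^ CARD('a) * ?q"
    unfolding char_polynomial_def map_matrix_const_poly_mult by (rule det_scalar_minus_mult_commute)
  show ?thesis
  \<comment> \<open>\<open>proots_mult\<close> asks for non-zero factors. Instead of proving the
    polynomials monic, \<open>eq\<close> is used to see that they can only vanish together.\<close>
  proof (cases "?p = 0 \<or> ?q = 0")
    case True
    with eq have "?p = 0 \<and> ?q = 0" by auto
    then show ?thesis by (simp add: nonzero_eigenvalues_def eigenvalues_def)
  next
    case False
    have nz: "{#l \<in># replicate_mset n 0. l \<noteq> 0#} = {#}" for n
      by (induction n) auto
    from False have "repeat_mset CARD('b) {#0#} + proots ?p = repeat_mset CARD('a) {#0#} + proots ?q"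
      using arg_cong[OF eq, of proots] by (simp add: proots_mult proots_power)
    from arg_cong[OF this, of "filter_mset (\<lambda>l. l \<noteq> 0)"]
    show ?thesis by (simp add: nonzero_eigenvalues_def eigenvalues_def nz)
  qed
qed

section \<open>The positive definite square root\<close>

lemma symmetric_inner:
  fixes A :: "real^'n^'n"
  assumes "transpose A = A"
  shows "x \<bullet> (A *v y) = (A *v x) \<bullet> y"
  by (metis assms dot_lmul_matrix vector_transpose_matrix)

lemma symmetric_matrixI:
  fixes A :: "real^'n^'n"
  assumes "\<And>x y. x \<bullet> (A *v y) = (A *v x) \<bullet> y"
  shows "transpose A = A"
proof -
  have "(transpose A *v x) \<bullet> y = (A *v x) \<bullet> y" for x y
    by (simp add: assms dot_lmul_matrix)
  then have "transpose A *v x = A *v x" for x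
    using vector_eq_rdot by blast
  then show ?thesis by (simp add: matrix_eq)
qed

text \<open>A maximizer \<open>u\<close> of \<open>x \<bullet> A x\<close> on the unit sphere of \<open>S\<close>, with maximum \<open>l\<close>, is a zero of the
  nonnegative form \<open>q x = l (x \<bullet> x) - x \<bullet> A x\<close>; moving from \<open>u\<close> along \<open>w = l u - A u\<close> would make \<open>q\<close>
  negative unless \<open>w = 0\<close>.\<close>

lemma symmetric_eigenvector_exists:
  fixes A :: "real^'n^'n"
  assumes A: "transpose A = A" and S: "subspace S" "S \<noteq> {0}"
    and inv: "\<And>x. x \<in> S \<Longrightarrow> A *v x \<in> S"
  obtains u l where "u \<in> S" "norm u = 1" "A *v u = l *\<^sub>R u"
proof -
  let ?K = "S \<inter> sphere 0 1"
  obtain z where z: "z \<in> S" "z \<noteq> 0"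
    using S subspace_0 by fastforce
  have "z /\<^sub>R norm z \<in> ?K"
    using z(2) subspace_scale[OF S(1) z(1)] by simp
  then have "?K \<noteq> {}" by blast
  moreover have "compact ?K"
    using closed_subspace[OF S(1)] by (simp add: closed_Int_compact)
  moreover have "continuous_on ?K (\<lambda>x. x \<bullet> (A *v x))"
    by (intro continuous_intros matrix_vector_mult_linear_continuous_on)
  ultimately obtain u where u: "u \<in> ?K" and max: "\<And>y. y \<in> ?K \<Longrightarrow> y \<bullet> (A *v y) \<le> u \<bullet> (A *v u)"
    using continuous_attains_sup[of ?K "\<lambda>x. x \<bullet> (A *v x)"] by blast
  define l where "l = u \<bullet> (A *v u)"
  define q where "q x = l * (x \<bullet> x) - x \<bullet> (A *v x)" for x
  have q_nonneg: "0 \<le> q x" if "x \<in> S" for x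
  proof (cases "x = 0")
    case False
    then have "x /\<^sub>R norm x \<in> ?K"
      using subspace_scale[OF S(1) that] by simp
    from max[OF this] have "(x \<bullet> (A *v x)) / (norm x)\<^sup>2 \<le> l"
      by (simp add: l_def matrix_vector_mult_scaleR power2_eq_square divide_inverse mult_ac)
    then show ?thesis
      using False by (simp add: q_def divide_simps power2_norm_eq_inner mult_ac)
  qed (simp add: q_def)
  define w where "w = l *\<^sub>R u - A *v u"
  have w: "w \<in> S"
    using u inv S by (simp add: w_def subspace_diff subspace_scale)
  have uu: "u \<bullet> u = 1"
    using u by (simp add: norm_eq_1)
  \<comment> \<open>There is no constant term because \<open>q u = 0\<close>; the linear coefficient
    is twice the squared length of \<open>w\<close>.\<close>
  have expand: "q (u + t *\<^sub>R w) = 2 * t * (w \<bullet> w) + t\<^sup>2 * q w" for t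
  proof -
    have ww: "l * (u \<bullet> w) - u \<bullet> (A *v w) = w \<bullet> w"
      using symmetric_inner[OF A, of u w] by (simp add: w_def inner_diff_left)
    have "w \<bullet> (A *v u) = u \<bullet> (A *v w)"
      using symmetric_inner[OF A, of u w] by (simp add: inner_commute)
    then have "q (u + t *\<^sub>R w) = 2 * t * (l * (u \<bullet> w) - u \<bullet> (A *v w)) + t\<^sup>2 * q w"
      by (simp add: q_def l_def[symmetric] uu matrix_vector_right_distrib matrix_vector_mult_scaleR
          inner_add_left inner_add_right inner_commute[of w u] algebra_simps power2_eq_square)
    then show ?thesis by (simp only: ww)
  qed
  have "w = 0"
  proof (rule ccontr)
    assume "w \<noteq> 0"
    then have pos: "0 < w \<bullet> w" by simp
    \<comment> \<open>A negative \<open>t\<close> small enough that the linear term dominates the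
      quadratic one. The summand 1 keeps the denominator positive when
      \<open>q w = 0\<close>.\<close>
    define t where "t = - (w \<bullet> w) / (1 + q w)"
    have qw: "0 \<le> q w" by (rule q_nonneg[OF w])
    then have "t < 0" using pos by (simp add: t_def divide_neg_pos)
    have "t * q w \<ge> - (w \<bullet> w)"
      using pos qw by (simp add: t_def field_simps)
    then have "0 < 2 * (w \<bullet> w) + t * q w"
      using pos by linarith
    then have "t * (2 * (w \<bullet> w) + t * q w) < 0"
      using \<open>t < 0\<close> by (simp add: mult_neg_pos)
    moreover have "0 \<le> q (u + t *\<^sub>R w)"
      using u w S by (intro q_nonneg) (simp add: subspace_add subspace_scale)
    ultimately show False
      by (simp add: expand power2_eq_square algebra_simps)
  qed
  then show thesis
    using that[of u l] u by (simp add: w_def)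
qed

text \<open>Induction on the dimension: split off a unit eigenvector \<open>u\<close>. By symmetry
  its orthogonal complement in \<open>S\<close> is again invariant, which is why the claim is made
  for all invariant subspaces.\<close>

lemma symmetric_orthonormal_eigenbasis_subspace:
  fixes A :: "real^'n^'n"
  assumes A: "transpose A = A" and S: "subspace S"
    and inv: "\<And>x. x \<in> S \<Longrightarrow> A *v x \<in> S"
  shows "\<exists>B. finite B \<and> pairwise orthogonal B \<and> (\<forall>b\<in>B. norm b = 1 \<and> (\<exists>l. A *v b = l *\<^sub>R b)) \<and> span B = S"
  using S inv
proof (induction "dim S" arbitrary: S rule: less_induct)
  case less
  show ?case
  proof (cases "S = {0}")
    case True
    then show ?thesis by (intro exI[of _ "{}"]) auto
  next
    case False
    then obtain u l where u: "u \<in> S" "norm u = 1" "A *v u = l *\<^sub>R u"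
      using symmetric_eigenvector_exists[OF A less.prems(1) False less.prems(2)] by blast
    let ?T = "{y \<in> S. u \<bullet> y = 0}"
    have uu: "u \<bullet> u = 1" using u by (simp add: norm_eq_1)
    have T: "subspace ?T"
      using less.prems(1) by (auto simp: subspace_def inner_add_right)
    have "u \<notin> ?T" using uu by simp
    then have "?T \<subset> S" using u(1) by blast
    moreover have "span ?T = ?T" "span S = S"
      using T less.prems(1) by (simp_all only: span_eq_iff)
    ultimately have "span ?T \<subset> span S" by metis
    then have "dim ?T < dim S" by (rule dim_psubset)
    moreover have "A *v y \<in> ?T" if "y \<in> ?T" for y
      using that less.prems(2) symmetric_inner[OF A, of u y] u(3) by simp
    ultimately obtain B where B: "finite B" "pairwise orthogonal B"
        "\<forall>b\<in>B. norm b = 1 \<and> (\<exists>l. A *v b = l *\<^sub>R b)" "span B = ?T"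
      using less.hyps T by meson
    have "b \<in> ?T" if "b \<in> B" for b using that B(4) span_base by blast
    then have "pairwise orthogonal (insert u B)"
      using B(2) by (auto simp: pairwise_insert orthogonal_def inner_commute)
    moreover have "span (insert u B) = S"
    proof
      show "span (insert u B) \<subseteq> S"
        using u(1) B(4) less.prems(1) span_superset by (intro span_minimal) blast+
      show "S \<subseteq> span (insert u B)"
      proof
        fix y assume "y \<in> S"
        then have "y - (u \<bullet> y) *\<^sub>R u \<in> ?T"
          using u(1) uu less.prems(1) by (simp add: subspace_diff subspace_scale inner_diff_right)
        then show "y \<in> span (insert u B)"
          unfolding span_insert B(4)[symmetric] by blast
      qed
    qed
    ultimately show ?thesis
      using B u by (intro exI[of _ "insert u B"]) auto
  qed
qed

lemma symmetric_orthonormal_eigenbasis: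
  fixes A :: "real^'n^'n"
  assumes "transpose A = A"
  obtains B l where "finite B" "pairwise orthogonal B" "span B = UNIV"
    "\<And>b. b \<in> B \<Longrightarrow> norm b = 1" "\<And>b. b \<in> B \<Longrightarrow> A *v b = l b *\<^sub>R b"
proof -
  obtain B where B: "finite B" "pairwise orthogonal B" "span B = UNIV"
      "\<forall>b\<in>B. norm b = 1 \<and> (\<exists>l. A *v b = l *\<^sub>R b)"
    using symmetric_orthonormal_eigenbasis_subspace[OF assms, of UNIV] by auto
  from B(4) have "\<forall>b\<in>B. \<exists>l. A *v b = l *\<^sub>R b" by blast
  then obtain l where "\<forall>b\<in>B. A *v b = l b *\<^sub>R b" by (rule bchoice[THEN exE])
  with B show thesis by (intro that[of B l]) auto
qed

section \<open>Square roots and inverses of positive definite matrices\<close>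

lemma orthonormal_sum_scaled_projections:
  assumes "finite B" "pairwise orthogonal B" "\<And>b. b \<in> B \<Longrightarrow> norm b = 1" "c \<in> B"
  shows "(\<Sum>b\<in>B. (l b * (b \<bullet> c)) *\<^sub>R b) = l c *\<^sub>R c"
proof -
  have "(\<Sum>b\<in>B. (l b * (b \<bullet> c)) *\<^sub>R b) = (\<Sum>b\<in>B. if b = c then l c *\<^sub>R c else 0)"
    using assms by (intro sum.cong) (auto simp: pairwise_def orthogonal_def norm_eq_1)
  also have "\<dots> = l c *\<^sub>R c" using assms by simp
  finally show ?thesis .
qed

text \<open>\<open>R\<close> keeps the orthonormal eigenbasis of \<open>A\<close> and replaces each
  eigenvalue by its square root. That \<open>R ** R\<close> equals \<open>A\<close> then only has to
  be checked on the basis.\<close>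

lemma positive_definite_sqrt_exists:
  fixes A :: "real^'n^'n"
  assumes A: "positive_definite A"
  obtains R where "positive_definite R" "R ** R = A"
proof -
  have sym: "transpose A = A" using A by (simp add: positive_definite_def)
  obtain B l where B: "finite B" "pairwise orthogonal B" "span B = UNIV"
    "\<And>b. b \<in> B \<Longrightarrow> norm b = 1" "\<And>b. b \<in> B \<Longrightarrow> A *v b = l b *\<^sub>R b"
    using symmetric_orthonormal_eigenbasis[OF sym] by blast
  have l: "0 < l b" if "b \<in> B" for b
  proof -
    have "0 < b \<bullet> (A *v b)"
      using A B(4)[OF that] unfolding positive_definite_def by (metis norm_zero zero_neq_one)
    then show ?thesis
      using B(4,5)[OF that] by (simp add: norm_eq_1)
  qed
  define f where "f x = (\<Sum>b\<in>B. (sqrt (l b) * (b \<bullet> x)) *\<^sub>R b)" for x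
  have lin: "linear f"
    unfolding f_def
    by (intro linearI) (simp_all add: inner_add_right algebra_simps sum.distrib scaleR_sum_right)
  define R where "R = matrix f"
  have R: "R *v x = f x" for x
    unfolding R_def by (rule matrix_works) (use lin in \<open>simp add: linear_matrix_vector_mul_eq\<close>)
  have "R *v (R *v b) = A *v b" if "b \<in> B" for b
  proof -
    have "R *v b = sqrt (l b) *\<^sub>R b"
      unfolding R f_def by (rule orthonormal_sum_scaled_projections) (use B that in auto)
    then show ?thesis
      using l[OF that] B(5)[OF that] by (simp add: matrix_vector_mult_scaleR)
  qed
  then have "(R ** R) *v x = A *v x" for x
    using linear_eq_on_span[of "\<lambda>x. R *v (R *v x)" "(*v) A" B x] B(3)
    by (simp add: linear_compose[unfolded o_def] flip: matrix_vector_mul_assoc)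
  then have "R ** R = A" by (simp add: matrix_eq)
  moreover have "positive_definite R"
    unfolding positive_definite_def
  proof (intro conjI allI impI)
    have "x \<bullet> (R *v y) = (R *v x) \<bullet> y" for x y
      unfolding R f_def by (simp add: inner_sum_left inner_sum_right inner_commute mult_ac)
    then show "transpose R = R" by (rule symmetric_matrixI)
    fix x :: "real^'n" assume "x \<noteq> 0"
    have "\<exists>b\<in>B. b \<bullet> x \<noteq> 0"
    proof (rule ccontr)
      assume "\<not> ?thesis"
      then have "\<forall>b\<in>B. orthogonal x b"
        by (simp add: orthogonal_def inner_commute)
      then show False
        using orthogonal_to_span[of x B x] B(3) \<open>x \<noteq> 0\<close> by (simp add: orthogonal_self)
    qed
    then obtain b where b: "b \<in> B" "b \<bullet> x \<noteq> 0" by blast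
    have "x \<bullet> (R *v x) = (\<Sum>b\<in>B. sqrt (l b) * (b \<bullet> x)\<^sup>2)"
      by (simp add: R f_def inner_sum_right power2_eq_square inner_commute mult_ac)
    also have "\<dots> > 0"
      using B(1) b l by (intro sum_pos2[of _ b]) (auto simp: less_imp_le)
    finally show "0 < x \<bullet> (R *v x)" .
  qed
  ultimately show thesis using that by blast
qed

text \<open>The difference \<open>D = R - T\<close> satisfies \<open>R D + D T = 0\<close>; pairing this with an eigenvector of \<open>D\<close>
  shows that the eigenvalue vanishes.\<close>

lemma positive_definite_sqrt_unique:
  fixes R :: "real^'n^'n"
  assumes R: "positive_definite R" and T: "positive_definite T" and eq: "R ** R = T ** T"
  shows "R = T"
proof -
  let ?D = "R - T"
  have "transpose ?D = ?D"
    using R T by (simp add: positive_definite_def transpose_def vec_eq_iff)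
  then obtain B l where B: "span B = UNIV"
    "\<And>b. b \<in> B \<Longrightarrow> norm b = 1" "\<And>b. b \<in> B \<Longrightarrow> ?D *v b = l b *\<^sub>R b"
    using symmetric_orthonormal_eigenbasis by metis
  have "?D *v b = 0" if b: "b \<in> B" for b
  proof -
    have "R *v (R *v b) = T *v (T *v b)"
      using eq by (simp add: matrix_vector_mul_assoc)
    then have "R *v (?D *v b) + ?D *v (T *v b) = 0"
      by (simp add: matrix_vector_mult_diff_distrib matrix_vector_mult_diff_rdistrib)
    then have "b \<bullet> (R *v (?D *v b)) + b \<bullet> (?D *v (T *v b)) = 0"
      by (metis inner_add_right inner_zero_right)
    moreover have "b \<bullet> (?D *v (T *v b)) = l b * (b \<bullet> (T *v b))"
      using symmetric_inner[OF \<open>transpose ?D = ?D\<close>] B(3)[OF b] by simp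
    moreover have "R *v (?D *v b) = l b *\<^sub>R (R *v b)"
      by (simp only: B(3)[OF b] matrix_vector_mult_scaleR)
    ultimately have "l b * (b \<bullet> (R *v b) + b \<bullet> (T *v b)) = 0"
      by (simp add: distrib_left)
    moreover have "b \<noteq> 0" using B(2)[OF b] by auto
    then have "0 < b \<bullet> (R *v b) + b \<bullet> (T *v b)"
      using R T by (simp add: positive_definite_def add_pos_pos)
    ultimately show ?thesis using B(3)[OF b] by simp
  qed
  then have "?D *v x = 0" for x
    using B(1) linear_eq_0_on_span[of "(*v) ?D" B x] by (simp)
  then show ?thesis
    by (simp add: matrix_eq matrix_vector_mult_diff_rdistrib)
qed

lemma pd_sqrt:
  assumes "positive_definite A"
  shows "positive_definite (pd_sqrt A)" "pd_sqrt A ** pd_sqrt A = A"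
proof -
  have "\<exists>!R. positive_definite R \<and> R ** R = A"
    using positive_definite_sqrt_exists[OF assms] positive_definite_sqrt_unique by metis
  from theI'[OF this]
  show "positive_definite (pd_sqrt A)" "pd_sqrt A ** pd_sqrt A = A"
    by (simp_all add: pd_sqrt_def)
qed

text \<open>A positive definite matrix has trivial kernel, so the choice made by
  \<open>matrix_inv\<close> does pick a two-sided inverse.\<close>

lemma matrix_inv_positive_definite:
  assumes "positive_definite A"
  shows "A ** matrix_inv A = mat 1" "matrix_inv A ** A = mat 1"
proof -
  have "x = 0" if "A *v x = 0" for x
    using assms that unfolding positive_definite_def by (metis inner_zero_right less_irrefl)
  then have "\<exists>M. M ** A = mat 1"
    by (simp add: matrix_left_invertible_ker)
  then have "\<exists>M. A ** M = mat 1 \<and> M ** A = mat 1"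
    using matrix_left_right_inverse by blast
  from someI_ex[OF this] show "A ** matrix_inv A = mat 1" "matrix_inv A ** A = mat 1"
    by (simp_all add: matrix_inv_def)
qed

section \<open>Information matrices\<close>

text \<open>\<open>A ** B\<close> and \<open>A ** D\<close> are symmetric and each absorbs the other
  from the left, so transposing their product identifies them. The same works for
  \<open>B ** A\<close> and \<open>D ** A\<close>.\<close>

lemma moore_penrose_unique:
  fixes A :: "real^'k^'n"
  assumes B: "is_moore_penrose A B" and D: "is_moore_penrose A D"
  shows "B = D"
proof -
  have "A ** B = A ** D"
  proof -
    have "A ** B = (A ** D) ** (A ** B)"
      using D by (simp add: is_moore_penrose_def matrix_mul_assoc)
    also have "\<dots> = transpose ((A ** B) ** (A ** D))"
      using B D by (simp add: is_moore_penrose_def matrix_transpose_mul)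
    also have "\<dots> = transpose (A ** D)"
      using B by (simp add: is_moore_penrose_def matrix_mul_assoc)
    finally show ?thesis using D by (simp add: is_moore_penrose_def)
  qed
  moreover have "B ** A = D ** A"
  proof -
    have "B ** A = (B ** A) ** (D ** A)"
      using D by (simp add: is_moore_penrose_def flip: matrix_mul_assoc)
    also have "\<dots> = transpose ((D ** A) ** (B ** A))"
      using B D by (simp add: is_moore_penrose_def matrix_transpose_mul)
    also have "\<dots> = transpose (D ** A)"
      using B by (simp add: is_moore_penrose_def flip: matrix_mul_assoc)
    finally show ?thesis using D by (simp add: is_moore_penrose_def)
  qed
  \<comment> \<open>The chain is B = BAB = BAD = DAD = D.\<close>
  ultimately show ?thesis
    using B D unfolding is_moore_penrose_def by (metis matrix_mul_assoc)
qed

lemma moore_penrose_eqI: "is_moore_penrose A B \<Longrightarrow> moore_penrose A = B"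
  unfolding moore_penrose_def by (blast intro: moore_penrose_unique)

text \<open>An orthonormal basis of \<open>S\<close> gives a projection as the sum of the matrices b
  b^T; by uniqueness the definite description denotes it.\<close>

lemma is_orth_proj_orth_proj:
  fixes S :: "(real^'n) set"
  assumes S: "subspace S"
  shows "is_orth_proj S (orth_proj S)"
proof -
  obtain B where B: "B \<subseteq> S" "pairwise orthogonal B" "\<And>b. b \<in> B \<Longrightarrow> norm b = 1"
      "independent B" "span B = S"
    using orthonormal_basis_subspace[OF S] by metis
  have fin: "finite B" using B(4) by (rule independent_imp_finite)
  define f where "f x = (\<Sum>b\<in>B. (b \<bullet> x) *\<^sub>R b)" for x
  have lin: "linear f"
    unfolding f_def
    by (intro linearI) (simp_all add: inner_add_right scaleR_add_left sum.distrib scaleR_sum_right)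
  have fS: "f x \<in> S" for x
    unfolding f_def using B(1) S by (intro subspace_sum subspace_scale) auto
  have "orthogonal y (x - f x)" if "y \<in> S" for x y
  proof -
    have "orthogonal (x - f x) b" if b: "b \<in> B" for b
    proof -
      have "f x \<bullet> b = (\<Sum>c\<in>B. if c = b then x \<bullet> b else 0)"
        unfolding f_def inner_sum_left using B(2,3) b
        by (intro sum.cong) (auto simp: pairwise_def orthogonal_def norm_eq_1 inner_commute)
      then show ?thesis
        using b fin by (simp add: orthogonal_def inner_diff_left)
    qed
    then show ?thesis
      using that B(5) orthogonal_to_span[of y B "x - f x"] by (simp add: orthogonal_commute)
  qed
  moreover have "matrix f *v x = f x" for x
    by (rule matrix_works) (use lin in \<open>simp add: linear_matrix_vector_mul_eq\<close>)
  ultimately have "is_orth_proj S (matrix f)"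
    using fS by (simp add: is_orth_proj_def)
  then show ?thesis
    using orth_proj_eqI[OF S] by simp
qed

lemma is_orth_proj_apply_self:
  assumes "is_orth_proj S P" "subspace S" "x \<in> S"
  shows "P *v x = x"
proof -
  have "x - P *v x \<in> S" using assms by (simp add: is_orth_proj_def subspace_diff)
  then have "orthogonal (x - P *v x) (x - P *v x)" using assms by (simp add: is_orth_proj_def)
  then show ?thesis by (simp add: orthogonal_self)
qed

text \<open>The residual of \<open>x\<close> is orthogonal to \<open>P *v y\<close>. The right-hand
  side is symmetric in \<open>x\<close> and \<open>y\<close>, which yields the symmetry of
  \<open>P\<close>.\<close>

lemma is_orth_proj_inner:
  assumes "is_orth_proj S P"
  shows "x \<bullet> (P *v y) = (P *v x) \<bullet> (P *v y)"
proof -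
  have "(P *v y) \<bullet> (x - P *v x) = 0"
    using assms by (simp add: is_orth_proj_def orthogonal_def)
  then show ?thesis by (simp add: inner_diff_right inner_commute)
qed

lemma transpose_orth_proj:
  assumes "is_orth_proj S P"
  shows "transpose P = P"
proof (rule symmetric_matrixI)
  show "x \<bullet> (P *v y) = (P *v x) \<bullet> y" for x y
    by (metis is_orth_proj_inner[OF assms] inner_commute)
qed

lemma orth_proj_mult:
  assumes "is_orth_proj S P" "subspace S" "column_space A \<subseteq> S"
  shows "P ** A = A"
proof -
  have "P *v (A *v x) = A *v x" for x
    using assms by (intro is_orth_proj_apply_self) (auto simp: column_space_eq_range)
  then show ?thesis by (simp add: matrix_eq flip: matrix_vector_mul_assoc)
qed

lemma transpose_diff: "transpose (A - B) = transpose A - transpose (B :: real^'k^'n)"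
  by (simp add: vec_eq_iff transpose_def)

lemma transpose_add: "transpose (A + B) = transpose A + transpose (B :: real^'k^'n)"
  by (simp add: vec_eq_iff transpose_def)

lemma transpose_information_matrix:
  "transpose (information_matrix X L) = information_matrix X L"
proof -
  have "transpose (orth_proj (column_space L)) = orth_proj (column_space L)"
    using transpose_orth_proj[OF is_orth_proj_orth_proj[of "column_space L"]]
    by (simp add: column_space_def)
  then show ?thesis
    by (simp add: information_matrix_def matrix_transpose_mul transpose_diff transpose_mat matrix_mul_assoc)
qed

section \<open>Column spaces and the weight matrix\<close>

lemma column_space_eqI:
  fixes Q :: "real^'s^'v"
  assumes "subspace E" "column_space Q \<subseteq> E" "rank Q = dim E"
  shows "column_space Q = E"
  using assms by (intro subspace_dim_equal)
    (simp_all add: column_space_def column_rank_def)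

lemma column_space_subset_factor:
  fixes A :: "real^'k^'n" and Q :: "real^'s^'n"
  assumes "column_space Q \<subseteq> column_space A"
  obtains Z where "Q = A ** Z"
proof -
  have "column j Q \<in> column_space A" for j
    using assms span_base[of "column j Q" "columns Q"] by (auto simp: column_space_def columns_def)
  then have "\<exists>z. A *v z = column j Q" for j
    unfolding column_space_eq_range[of A] by (metis imageE)
  then obtain z where z: "\<And>j. A *v z j = column j Q" by metis
  have "Q $ i $ j = (A *v z j) $ i" for i j
    by (simp add: z column_def)
  then have "Q = A ** (\<chi> i j. z j $ i)"
    by (simp add: vec_eq_iff matrix_matrix_mult_def matrix_vector_mult_def)
  then show thesis by (rule that)
qed

text \<open>The quadratic form is |x - Px|^2 + |Q^T x|^2. If both terms vanish, \<open>x\<close>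
  lies in the column space of \<open>Q\<close> and is orthogonal to it.\<close>

lemma positive_definite_weight_matrix:
  fixes Q :: "real^'s^'v"
  assumes E: "subspace E" and Q: "column_space Q = E"
  shows "positive_definite (weight_matrix E Q)"
  unfolding positive_definite_def
proof (intro conjI allI impI)
  define P where "P = orth_proj E"
  have P: "is_orth_proj E P" using is_orth_proj_orth_proj[OF E] by (simp add: P_def)
  show "transpose (weight_matrix E Q) = weight_matrix E Q"
    by (simp add: weight_matrix_def transpose_add transpose_diff transpose_mat
        matrix_transpose_mul flip: P_def) (simp add: transpose_orth_proj[OF P])
  fix x :: "real^'v" assume "x \<noteq> 0"
  have QQ: "x \<bullet> (Q *v y) = (transpose Q *v x) \<bullet> y" for y
    by (metis dot_lmul_matrix transpose_matrix_vector)
  have "(x - P *v x) \<bullet> (P *v x) = 0"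
    using is_orth_proj_inner[OF P, of x x] by (simp add: inner_diff_left)
  then have "x \<bullet> (x - P *v x) = (x - P *v x) \<bullet> (x - P *v x)"
    by (simp add: inner_diff_left inner_diff_right inner_commute)
  then have eq: "x \<bullet> (weight_matrix E Q *v x) =
      (x - P *v x) \<bullet> (x - P *v x) + (transpose Q *v x) \<bullet> (transpose Q *v x)"
    by (simp add: weight_matrix_def P_def[symmetric] matrix_vector_mult_add_rdistrib
        matrix_vector_mult_diff_rdistrib matrix_vector_mul_assoc[symmetric] QQ inner_add_right
        del: transpose_matrix_vector)
  show "0 < x \<bullet> (weight_matrix E Q *v x)"
  proof (cases "x = P *v x")
    case True
    then have "x \<in> range ((*v) Q)"
      using P Q unfolding is_orth_proj_def column_space_eq_range by metis
    \<comment> \<open>With this \<open>z\<close>, the inner product of Q^T x and \<open>z\<close> is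
      |x|^2, so Q^T x cannot be zero.\<close>
    then obtain z where "x = Q *v z" by blast
    then have "transpose Q *v x \<noteq> 0"
      using QQ[of z] \<open>x \<noteq> 0\<close> by (metis inner_eq_zero_iff inner_zero_left)
    then have "0 < (transpose Q *v x) \<bullet> (transpose Q *v x)"
      using inner_gt_zero_iff by blast
    then show ?thesis unfolding eq by (simp add: add_nonneg_pos del: transpose_matrix_vector)
  next
    case False
    then have "0 < (x - P *v x) \<bullet> (x - P *v x)" by simp
    then show ?thesis unfolding eq by (simp add: add_pos_nonneg del: transpose_matrix_vector)
  qed
qed

text \<open>Moving the left factor W^(-1/2) cyclically to the right end produces W^(-1), at the
  price of a matrix that need not be symmetric.\<close>

lemma nonzero_eigenvalues_weighted_information_matrix:
  assumes W: "positive_definite W"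
  shows "nonzero_eigenvalues (weighted_information_matrix W C) =
    nonzero_eigenvalues (C ** matrix_inv W)"
proof -
  let ?R = "pd_sqrt W"
  note R = pd_sqrt[OF W]
  note I = matrix_inv_positive_definite
  have "matrix_inv ?R ** matrix_inv ?R ** W = mat 1"
    using I(2)[OF R(1)] R(2) by (metis matrix_mul_assoc matrix_mul_rid)
  then have "matrix_inv ?R ** matrix_inv ?R = matrix_inv W"
    using I(1)[OF W] by (metis matrix_mul_assoc matrix_mul_lid matrix_mul_rid)
  then show ?thesis
    unfolding weighted_information_matrix_def
    by (metis matrix_mul_assoc nonzero_eigenvalues_mult_commute)
qed

theorem theorem1:
  fixes X :: "'d \<Rightarrow> real^'v^'n" and L :: "real^'m^'n"
    and designs :: "'d set" and \<xi> :: 'd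
    and E :: "(real^'v) set" and Q :: "real^'s^'v" and G :: "real^'v^'v"
  assumes "subspace E"
    and "\<And>\<eta>. \<eta> \<in> designs \<Longrightarrow> column_space (information_matrix (X \<eta>) L) = E"
    and "column_space Q \<subseteq> E"
    and "rank Q = dim E"
    and "\<xi> \<in> designs"
    and "feasible (information_matrix (X \<xi>) L) Q"
    and "is_generalized_inverse (information_matrix (X \<xi>) L) G"
  shows "nonzero_eigenvalues (system_information_matrix Q G) =
    nonzero_eigenvalues
      (weighted_information_matrix (weight_matrix E Q) (information_matrix (X \<xi>) L))"
proof -
  define C where "C = information_matrix (X \<xi>) L"
  define P where "P = orth_proj E"
  define W where "W = weight_matrix E Q"
  define V where "V = matrix_inv W"
  \<comment> \<open>Here Q^T V is the Moore-Penrose inverse Q^+ of \<open>Q\<close>, so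
    \<open>N\<close> is Q^+ C (Q^+)^T, the natural candidate for inverting Q^T G Q.\<close>
  define N where "N = transpose Q ** V ** C ** V ** Q"
  have P: "is_orth_proj E P"
    using is_orth_proj_orth_proj[OF assms(1)] by (simp add: P_def)
  have Ct: "transpose C = C"
    by (simp add: C_def transpose_information_matrix)
  have Pt: "transpose P = P" by (rule transpose_orth_proj[OF P])
  have PC: "P ** C = C"
    by (rule orth_proj_mult[OF P assms(1)]) (simp add: C_def assms(2,5))
  then have CP: "C ** P = C"
    by (metis Ct Pt matrix_transpose_mul)
  have PQ: "P ** Q = Q"
    by (rule orth_proj_mult[OF P assms(1,3)])
  have W: "positive_definite W"
    unfolding W_def
    by (intro positive_definite_weight_matrix assms(1) column_space_eqI assms(3,4))
  have WV: "W ** V = mat 1" and VW: "V ** W = mat 1"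
    using matrix_inv_positive_definite[OF W] by (simp_all add: V_def)
  have Wt: "transpose W = W" using W by (simp add: positive_definite_def)
  have Vt: "transpose V = V"
    by (metis VW WV Wt matrix_mul_assoc matrix_mul_lid matrix_mul_rid matrix_transpose_mul transpose_mat)
  have W_eq: "W = mat 1 - P + Q ** transpose Q"
    by (simp add: W_def P_def weight_matrix_def)
  have PW: "P ** W = Q ** transpose Q"
  proof -
    have "P ** P = P"
      by (rule orth_proj_mult[OF P assms(1)]) (use P in \<open>auto simp: column_space_eq_range is_orth_proj_def\<close>)
    then have "P ** (mat 1 - P) = 0"
      by (simp add: matrix_eq matrix_vector_mult_diff_rdistrib matrix_vector_mult_diff_distrib
          flip: matrix_vector_mul_assoc)
    then show ?thesis
      by (simp add: W_eq matrix_add_ldistrib matrix_mul_assoc PQ)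
  qed
  have QV: "Q ** transpose Q ** V = P"
    by (metis PW WV matrix_mul_assoc matrix_mul_rid)
  then have VQ: "V ** Q ** transpose Q = P"
    by (metis Pt Vt matrix_mul_assoc matrix_transpose_mul transpose_transpose)
  \<comment> \<open>Feasibility enters through this factorization: it gives CGQ = Q and, as
    \<open>C\<close> is symmetric, Q^T G C = Q^T, although \<open>G\<close> itself need not be
    symmetric.\<close>
  obtain Z where Z: "Q = C ** Z"
    using assms(6) column_space_subset_factor unfolding feasible_def C_def by metis
  have CGC: "C ** G ** C = C"
    using assms(7) by (simp add: is_generalized_inverse_def C_def)
  have CGQ: "C ** G ** Q = Q"
    by (metis CGC Z matrix_mul_assoc)
  have QGC: "transpose Q ** G ** C = transpose Q"
    by (metis CGC Ct Z matrix_mul_assoc matrix_transpose_mul)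
  let ?M = "transpose Q ** G ** Q"
  \<comment> \<open>Both products of \<open>?M\<close> and \<open>N\<close> reduce to Q^T V Q, from
    which \<open>G\<close> has disappeared. This matrix is symmetric, which settles two of the
    Penrose equations.\<close>
  have MN: "?M ** N = transpose Q ** V ** Q"
  proof -
    have "?M ** N = transpose Q ** G ** (Q ** transpose Q ** V) ** C ** V ** Q"
      by (simp add: N_def matrix_mul_assoc)
    also have "\<dots> = transpose Q ** G ** (P ** C) ** V ** Q"
      by (simp add: QV matrix_mul_assoc)
    finally show ?thesis by (simp add: PC QGC)
  qed
  have NM: "N ** ?M = transpose Q ** V ** Q"
  proof -
    have "N ** ?M = transpose Q ** V ** (C ** (V ** Q ** transpose Q)) ** G ** Q"
      by (simp add: N_def matrix_mul_assoc)
    also have "\<dots> = transpose Q ** V ** (C ** G ** Q)"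
      by (simp add: VQ CP matrix_mul_assoc)
    finally show ?thesis by (simp add: CGQ)
  qed
  have "is_moore_penrose ?M N"
    unfolding is_moore_penrose_def
  proof (intro conjI)
    have "?M ** N ** ?M = transpose Q ** (V ** Q ** transpose Q) ** G ** Q"
      by (simp add: MN matrix_mul_assoc)
    \<comment> \<open>The bracket is \<open>P\<close>, and Q^T P = Q^T is the transpose of
      \<open>PQ\<close>.\<close>
    also have "\<dots> = ?M"
      by (metis PQ Pt VQ matrix_transpose_mul)
    finally show "?M ** N ** ?M = ?M" .
    have "N ** ?M ** N = transpose Q ** V ** (Q ** transpose Q ** V) ** C ** V ** Q"
      by (simp add: NM) (simp add: N_def matrix_mul_assoc)
    also have "\<dots> = transpose Q ** V ** (P ** C) ** V ** Q"
      by (simp add: QV matrix_mul_assoc)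
    finally show "N ** ?M ** N = N" by (simp add: PC N_def)
  qed (simp_all only: MN NM, simp_all add: matrix_transpose_mul Vt matrix_mul_assoc)
  then have "system_information_matrix Q G = (transpose Q ** V) ** (C ** V ** Q)"
    by (simp add: system_information_matrix_def moore_penrose_eqI N_def matrix_mul_assoc)
  then have "nonzero_eigenvalues (system_information_matrix Q G) =
      nonzero_eigenvalues (C ** (V ** Q ** transpose Q) ** V)"
    using nonzero_eigenvalues_mult_commute[of "transpose Q ** V" "C ** V ** Q"]
    by (simp add: matrix_mul_assoc)
  also have "\<dots> = nonzero_eigenvalues (weighted_information_matrix W C)"
    by (simp only: VQ CP nonzero_eigenvalues_weighted_information_matrix[OF W] flip: V_def)
  finally show ?thesis by (simp add: W_def C_def)
qed

end
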